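(* Let $\mathbb{F}_q$ be a finite field, $k\ge 1$, and let $G(z)=(g_{i,j}(z))\in\mathbb{F}_q[z]^{k\times 2k}$ be a matrix whose only possibly nonzero entries are $g_{i,i}(z)$ and $g_{i,k+i}(z)$ for $1\le i\le k$. Then $G(z)$ is a generator matrix of a self-dual convolutional code if and only if for every $i\in\{1,\dots,k\}$ one has $g_{i,i}(z)=a_i$ and $g_{i,k+i}(z)=b_i$ for constants $a_i,b_i\in\mathbb{F}_q^*$ with $a_i^2=-b_i^2$ in $\mathbb{F}_q$. Consequently, self-dual convolutional codes with a generator matrix of this form exist over $\mathbb{F}_q$ if and only if self-dual $(2,1)$ block codes exist over $\mathbb{F}_q$.
   Context: An $(n,k)$ convolutional code over $\mathbb{F}_q$ is an $\mathbb{F}_q[z]$-submodule $\mathcal{C}\subset\mathbb{F}_q[z]^n$ of rank $k$. A generator matrix of $\mathcal{C}$ is a matrix $G(z)\in\mathbb{F}_q[z]^{k\times n}$ whose rows form a basis of $\mathcal{C}$. The dual is $\mathcal{C}^\perp=\{f(z)\in\mathbb{F}_q[z]^n : f(z)c(z)^\top=0\ \forall c(z)\in\mathcal{C}\}$, and $\mathcal{C}$ is self-dual if $\mathcal{C}=\mathcal{C}^\perp$. A $(2,1)$ block code is a one-dimensional subspace $C\subset\mathbb{F}_q^2$; it is self-dual if $C=\{x\in\mathbb{F}_q^2 : xc^\top=0\ \forall c\in C\}$. *)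

theory Defs
  imports
    "HOL-Computational_Algebra.Polynomial"
    "Jordan_Normal_Form.VS_Connect"
begin

text \<open>
  The field with q elements is a type of class \<open>{field, finite}\<close>; the ring of polynomials over it
  is the corresponding type \<open>poly\<close>. Codes of length n are sets of vectors in \<open>carrier_vec n\<close>,
  seen inside the module \<open>module_vec\<close> of all vectors of length n over the coefficient ring.
  Matrix and vector indices start at 0.
\<close>

text \<open>
  Span and linear independence taken in the ambient module agree with those taken in the
  submodule \<open>C\<close>.
\<close>
definition is_basis_of :: "nat \<Rightarrow> 'a::comm_ring_1 vec set \<Rightarrow> 'a vec set \<Rightarrow> bool" where
  "is_basis_of n C B \<longleftrightarrow>
     B \<subseteq> C \<and>
     \<not> LinearCombinations.module.lin_dep class_ring (module_vec TYPE('a) n) B \<and>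
     LinearCombinations.module.span class_ring (module_vec TYPE('a) n) B = C"

text \<open>
  Submodules of a finite free module over a principal ideal domain are free, so that
  rank k means having a basis with k elements.
\<close>
definition convolutional_code :: "nat \<Rightarrow> nat \<Rightarrow> 'a::{field,finite} poly vec set \<Rightarrow> bool" where
  "convolutional_code n k C \<longleftrightarrow>
     LinearCombinations.submodule class_ring C (module_vec TYPE('a poly) n) \<and>
     (\<exists>B. finite B \<and> card B = k \<and> is_basis_of n C B)"

text \<open>
  Distinctness is needed because the basis is the family of rows, while linear independence
  is a property of the set of rows.
\<close>
definition generator_matrix ::
  "nat \<Rightarrow> nat \<Rightarrow> 'a::{field,finite} poly vec set \<Rightarrow> 'a poly mat \<Rightarrow> bool" where
  "generator_matrix n k C G \<longleftrightarrow>
     G \<in> carrier_mat k n \<and> distinct (rows G) \<and> is_basis_of n C (set (rows G))"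

definition block_code :: "nat \<Rightarrow> nat \<Rightarrow> 'a::{field,finite} vec set \<Rightarrow> bool" where
  "block_code n k C \<longleftrightarrow>
     VectorSpace.subspace class_ring C (module_vec TYPE('a) n) \<and>
     vectorspace.dim class_ring ((module_vec TYPE('a) n)\<lparr>carrier := C\<rparr>) = k"

definition dual_code :: "nat \<Rightarrow> 'a::comm_ring_1 vec set \<Rightarrow> 'a vec set" where
  "dual_code n C = {f \<in> carrier_vec n. \<forall>c\<in>C. f \<bullet> c = 0}"

definition self_dual :: "nat \<Rightarrow> 'a::comm_ring_1 vec set \<Rightarrow> bool" where
  "self_dual n C \<longleftrightarrow> C = dual_code n C"

definition generates_self_dual_code :: "nat \<Rightarrow> nat \<Rightarrow> 'a::{field,finite} poly mat \<Rightarrow> bool" where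
  "generates_self_dual_code n k G \<longleftrightarrow>
     (\<exists>C. convolutional_code n k C \<and> self_dual n C \<and> generator_matrix n k C G)"

definition two_diagonal_form :: "nat \<Rightarrow> 'a::zero mat \<Rightarrow> bool" where
  "two_diagonal_form k G \<longleftrightarrow>
     G \<in> carrier_mat k (2 * k) \<and>
     (\<forall>i<k. \<forall>j<2 * k. j \<noteq> i \<and> j \<noteq> k + i \<longrightarrow> G $$ (i, j) = 0)"

end

theory Submission
  imports Defs "Jordan_Normal_Form.DL_Rank"
begin

text \<open>
  Let \<open>a\<close>, \<open>b\<close> be the entries of row \<open>i\<close>. Self-orthogonality of the row gives \<open>a\<^sup>2 = - b\<^sup>2\<close>.
  Since the rows have disjoint supports, every vector supported on the coordinates \<open>i\<close>, \<open>k + i\<close>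
  and orthogonal to row \<open>i\<close> lies in the dual, so by self-duality it is a multiple of row \<open>i\<close>.
  Applied to \<open>(- b, a)\<close> this yields \<open>c\<close> with \<open>a c = - b\<close> and \<open>b c = a\<close>; then \<open>(1, - c)\<close> is also
  orthogonal to the row, hence a multiple of it, which makes \<open>a\<close> a unit. Nothing here is specific
  to polynomials: the characterization holds over every integral domain, and over the field
  itself with \<open>k = 1\<close> it describes the self-dual (2,1) block codes.
\<close>

section \<open>Row spans of a matrix and their duals over an integral domain\<close>

lemma rows_subset_carrier_vec: "G \<in> carrier_mat k n \<Longrightarrow> set (rows G) \<subseteq> carrier_vec n"
  by (metis carrier_matD(2) rows_carrier)

lemma mat_of_cols_rows: "G \<in> carrier_mat k n \<Longrightarrow> mat_of_cols n (rows G) = transpose_mat G"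
  by (metis carrier_matD(2) cols_transpose index_transpose_mat(2) mat_of_cols_cols)

context idom_vec
begin

text \<open>The coefficients of a combination of the rows are the entries of \<open>x\<close>.
  Combinations of lists rather than of sets are used, so repeated rows do no harm.\<close>

lemma span_rows:
  assumes G: "G \<in> carrier_mat k n"
  shows "span (set (rows G)) = {transpose_mat G *\<^sub>v x | x. x \<in> carrier_vec k}"
proof -
  have rows: "set (rows G) \<subseteq> carrier_vec n" "length (rows G) = k"
    using G rows_subset_carrier_vec by auto
  have "lincomb_list c (rows G) = transpose_mat G *\<^sub>v vec k c" for c
    using lincomb_list_as_mat_mult[of "rows G" c] rows mat_of_cols_rows[OF G] carrier_vecD
    by (metis subsetD)
  then have "span (set (rows G)) = range (\<lambda>c. transpose_mat G *\<^sub>v vec k c)"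
    unfolding span_list_as_span[OF rows(1), symmetric] span_list_def by auto
  also have "\<dots> = {transpose_mat G *\<^sub>v x | x. x \<in> carrier_vec k}"
  proof (intro equalityI subsetI)
    fix v assume "v \<in> {transpose_mat G *\<^sub>v x | x. x \<in> carrier_vec k}"
    then obtain x where "x \<in> carrier_vec k" "v = transpose_mat G *\<^sub>v x" by blast
    moreover from this have "x = vec k (($) x)" by (auto intro!: eq_vecI)
    ultimately show "v \<in> range (\<lambda>c. transpose_mat G *\<^sub>v vec k c)" by (metis rangeI)
  qed (use vec_carrier in blast)
  finally show ?thesis .
qed

text \<open>Independence concerns the set of rows, whereas \<open>x\<close> is indexed by their
  positions. Distinctness lets a coefficient function \<open>f\<close> on the set be read as the
  vector with entries \<open>f (rows G ! i)\<close>, to which injectivity applies.\<close>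

lemma lin_indpt_rows:
  assumes G: "G \<in> carrier_mat k n" and dist: "distinct (rows G)"
    and inj: "\<And>x. x \<in> carrier_vec k \<Longrightarrow> transpose_mat G *\<^sub>v x = 0\<^sub>v n \<Longrightarrow> x = 0\<^sub>v k"
  shows "lin_indpt (set (rows G))"
proof (rule finite_lin_indpt2)
  show carr: "set (rows G) \<subseteq> carrier_vec n"
    using G by (rule rows_subset_carrier_vec)
  fix f assume 0: "lincomb f (set (rows G)) = 0\<^sub>v n"
  have "transpose_mat G *\<^sub>v vec k (\<lambda>i. f (rows G ! i)) = 0\<^sub>v n"
    using 0 lincomb_list_as_mat_mult[of "rows G" "\<lambda>i. f (rows G ! i)"] carr
      mat_of_cols_rows[OF G] carrier_vecD carrier_matD(1)[OF G] length_rows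
    unfolding lincomb_as_lincomb_list_distinct[OF carr dist] by (metis subsetD)
  then have "vec k (\<lambda>i. f (rows G ! i)) = 0\<^sub>v k"
    by (intro inj) auto
  then have "f (rows G ! i) = 0" if "i < k" for i
    using that by (metis index_vec index_zero_vec(1))
  then show "\<forall>v\<in>set (rows G). f v = 0"
    using G by (auto simp: in_set_conv_nth)
qed simp

text \<open>By adjointness, \<open>y\<close> times \<open>transpose_mat G *\<^sub>v x\<close> equals
  \<open>x\<close> times \<open>G *\<^sub>v y\<close>. If this vanishes for all \<open>x\<close>,
  taking unit vectors for \<open>x\<close> shows that every coordinate of
  \<open>G *\<^sub>v y\<close> is zero.\<close>

lemma dual_code_span_rows:
  assumes G: "G \<in> carrier_mat k n"
  shows "dual_code n (span (set (rows G))) = {y \<in> carrier_vec n. G *\<^sub>v y = 0\<^sub>v k}"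
proof -
  have "(\<forall>x \<in> carrier_vec k. y \<bullet> (transpose_mat G *\<^sub>v x) = 0) \<longleftrightarrow> G *\<^sub>v y = 0\<^sub>v k"
    if y: "y \<in> carrier_vec n" for y
  proof -
    have Gy: "G *\<^sub>v y \<in> carrier_vec k" using G y by simp
    have adj: "y \<bullet> (transpose_mat G *\<^sub>v x) = x \<bullet> (G *\<^sub>v y)" if "x \<in> carrier_vec k" for x
      using transpose_vec_mult_scalar[OF G y that] comm_scalar_prod[OF y] G that
      by (metis mult_mat_vec_carrier transpose_carrier_mat)
    have "G *\<^sub>v y = 0\<^sub>v k" if "\<forall>x \<in> carrier_vec k. x \<bullet> (G *\<^sub>v y) = 0"
    proof (rule eq_vecI)
      fix i assume "i < dim_vec (0\<^sub>v k :: 'a vec)"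
      then show "(G *\<^sub>v y) $ i = 0\<^sub>v k $ i"
        using scalar_prod_left_unit[OF Gy, of i] that by simp
    qed (use G in simp)
    then show ?thesis using adj by auto
  qed
  then show ?thesis
    unfolding dual_code_def span_rows[OF G] by blast
qed

end

section \<open>Products with a two-diagonal matrix and its transpose\<close>

lemma sum_two_support:
  fixes f :: "nat \<Rightarrow> 'a::comm_monoid_add"
  assumes "i < k" and "\<And>j. j < 2 * k \<Longrightarrow> j \<noteq> i \<Longrightarrow> j \<noteq> k + i \<Longrightarrow> f j = 0"
  shows "sum f {0..<2 * k} = f i + f (k + i)"
proof -
  have "sum f {0..<2 * k} = sum f {i, k + i}"
  proof (intro sum.mono_neutral_right ballI)
    fix j assume "j \<in> {0..<2 * k} - {i, k + i}"
    then show "f j = 0" using assms(2)[of j] by simp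
  qed (use assms(1) in auto)
  then show ?thesis
    using assms(1) by simp
qed

lemma two_diagonal_mult_vec:
  fixes G :: "'a::comm_ring_1 mat"
  assumes "two_diagonal_form k G" "i < k" "y \<in> carrier_vec (2 * k)"
  shows "(G *\<^sub>v y) $ i = G $$ (i, i) * y $ i + G $$ (i, k + i) * y $ (k + i)"
proof -
  have G: "G \<in> carrier_mat k (2 * k)"
    using assms(1) by (simp add: two_diagonal_form_def)
  then have "(G *\<^sub>v y) $ i = (\<Sum>j = 0..<2 * k. G $$ (i, j) * y $ j)"
    using assms by (auto simp: scalar_prod_def intro!: sum.cong)
  also have "\<dots> = G $$ (i, i) * y $ i + G $$ (i, k + i) * y $ (k + i)"
    using assms by (intro sum_two_support) (auto simp: two_diagonal_form_def)
  finally show ?thesis .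
qed

text \<open>Columns \<open>i\<close> and \<open>k + i\<close> can be nonzero only in row
  \<open>i\<close>, so the single coefficient \<open>x $ i\<close> governs both coordinates of the
  combination.\<close>

lemma two_diagonal_transpose_mult_vec:
  fixes G :: "'a::comm_ring_1 mat"
  assumes "two_diagonal_form k G" "i < k" "x \<in> carrier_vec k"
  shows "(transpose_mat G *\<^sub>v x) $ i = G $$ (i, i) * x $ i"
    and "(transpose_mat G *\<^sub>v x) $ (k + i) = G $$ (i, k + i) * x $ i"
proof -
  have G: "G \<in> carrier_mat k (2 * k)"
    using assms(1) by (simp add: two_diagonal_form_def)
  have *: "(transpose_mat G *\<^sub>v x) $ j = G $$ (i, j) * x $ i" if "j = i \<or> j = k + i" for j
  proof -
    have "(transpose_mat G *\<^sub>v x) $ j = (\<Sum>l = 0..<k. G $$ (l, j) * x $ l)"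
      using G assms that by (auto simp: scalar_prod_def intro!: sum.cong)
    also have "\<dots> = (\<Sum>l \<in> {i}. G $$ (l, j) * x $ l)"
    proof (intro sum.mono_neutral_right ballI)
      fix l assume "l \<in> {0..<k} - {i}"
      then have "G $$ (l, j) = 0"
        using assms(1,2) that unfolding two_diagonal_form_def by auto
      then show "G $$ (l, j) * x $ l = 0" by simp
    qed (use assms(2) in auto)
    finally show ?thesis by simp
  qed
  show "(transpose_mat G *\<^sub>v x) $ i = G $$ (i, i) * x $ i"
    and "(transpose_mat G *\<^sub>v x) $ (k + i) = G $$ (i, k + i) * x $ i"
    by (rule *, simp)+
qed

section \<open>The characterization over an integral domain\<close>

lemma self_dual_two_diagonal_units:
  fixes G :: "'a::idom mat"
  assumes form: "two_diagonal_form k G" and basis: "is_basis_of (2 * k) C (set (rows G))"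
    and self_dual: "self_dual (2 * k) C" and i: "i < k"
  shows "G $$ (i, i) dvd 1" "G $$ (i, k + i) dvd 1" "(G $$ (i, i))\<^sup>2 = - (G $$ (i, k + i))\<^sup>2"
proof -
  interpret idom_vec "2 * k" "TYPE('a)" .
  let ?a = "G $$ (i, i)" and ?b = "G $$ (i, k + i)"
  have G: "G \<in> carrier_mat k (2 * k)"
    using form by (simp add: two_diagonal_form_def)
  have C: "C = span (set (rows G))" and indpt: "lin_indpt (set (rows G))"
    using basis by (auto simp: is_basis_of_def)
  have C_dual: "y \<in> C \<longleftrightarrow> y \<in> carrier_vec (2 * k) \<and> G *\<^sub>v y = 0\<^sub>v k" for y
    using self_dual dual_code_span_rows[OF G] unfolding self_dual_def C by blast
  have coords: "\<exists>c. ?a * c = p \<and> ?b * c = q" if pq: "?a * p + ?b * q = 0" for p q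
  proof -
    define y where "y = vec (2 * k) (\<lambda>j. if j = i then p else if j = k + i then q else 0)"
    have y: "y \<in> carrier_vec (2 * k)" by (simp add: y_def)
    have "(G *\<^sub>v y) $ j = 0" if "j < k" for j
      using two_diagonal_mult_vec[OF form that y] that pq i by (auto simp: y_def)
    then have "G *\<^sub>v y = 0\<^sub>v k"
      using G by (intro eq_vecI) auto
    then have "y \<in> C" using y C_dual by blast
    then obtain x where x: "x \<in> carrier_vec k" "y = transpose_mat G *\<^sub>v x"
      unfolding C span_rows[OF G] by blast
    have "y $ i = p" "y $ (k + i) = q" using i by (auto simp: y_def)
    then show ?thesis
      using two_diagonal_transpose_mult_vec[OF form i x(1)] x(2) by metis
  qed
  have row: "row G i \<in> set (rows G)" using G i by (simp add: rows_def)
  then have "row G i \<in> C"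
    using in_own_span[of "set (rows G)"] rows_subset_carrier_vec[OF G] unfolding C by auto
  \<comment> \<open>This coordinate is the product of row \<open>i\<close> with itself.\<close>
  then have "(G *\<^sub>v row G i) $ i = 0" using C_dual i by auto
  then have sq: "?a * ?a + ?b * ?b = 0"
    using two_diagonal_mult_vec[OF form i, of "row G i"] G i by simp
  then show "?a\<^sup>2 = - ?b\<^sup>2"
    by (simp add: power2_eq_square eq_neg_iff_add_eq_0)
  have "row G i \<noteq> 0\<^sub>v (2 * k)"
    using zero_lin_dep indpt row by (metis UNIV_I zero_neq_one singletonD)
  moreover have "row G i = 0\<^sub>v (2 * k)" if "?a = 0" "?b = 0"
    using that form i G by (intro eq_vecI) (auto simp: two_diagonal_form_def)
  ultimately have nz: "?a \<noteq> 0 \<or> ?b \<noteq> 0" by blast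
  obtain c where c: "?a * c = - ?b" "?b * c = ?a"
    using coords[of "- ?b" ?a] by (auto simp: algebra_simps)
  obtain d where d: "?a * d = 1" "?b * d = - c"
    using coords[of 1 "- c"] c(2) by auto
  show "?a dvd 1" using d(1) by (metis dvd_triv_left)
  \<comment> \<open>With \<open>d\<close> inverse to \<open>?a\<close> and the squares of
    \<open>?a\<close> and \<open>?b\<close> opposite, the inverse of \<open>?b\<close> is
    \<open>- (?b * d * d)\<close>.\<close>
  have "?b * (- (?b * d * d)) = - (?b * ?b) * (d * d)" by (simp add: algebra_simps)
  also have "\<dots> = ?a * d * (?a * d)"
    using sq unfolding eq_neg_iff_add_eq_0[symmetric] by (simp add: algebra_simps)
  finally show "?b dvd 1" using d(1) by (metis dvd_triv_left mult_1)
qed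

text \<open>The relation between the squares makes the rows self-orthogonal, so the span lies in its
  dual. Conversely, for \<open>y\<close> in the dual, the unit \<open>G $$ (i, i)\<close> fixes the
  coefficient of row \<open>i\<close> from \<open>y $ i\<close>, and the same relation makes
  coordinate \<open>k + i\<close> agree as well.\<close>

lemma units_self_dual_two_diagonal:
  fixes G :: "'a::idom mat"
  defines "C n \<equiv> LinearCombinations.module.span class_ring (module_vec TYPE('a) n) (set (rows G))"
  assumes form: "two_diagonal_form k G"
    and units: "\<And>i. i < k \<Longrightarrow> G $$ (i, i) dvd 1"
    and sq: "\<And>i. i < k \<Longrightarrow> (G $$ (i, i))\<^sup>2 = - (G $$ (i, k + i))\<^sup>2"
  shows "distinct (rows G)" "is_basis_of (2 * k) (C (2 * k)) (set (rows G))"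
    "self_dual (2 * k) (C (2 * k))"
proof -
  interpret idom_vec "2 * k" "TYPE('a)" .
  have G: "G \<in> carrier_mat k (2 * k)"
    using form by (simp add: two_diagonal_form_def)
  have nz: "G $$ (i, i) \<noteq> 0" if "i < k" for i
    using units[OF that] by auto
  \<comment> \<open>Column \<open>i\<close> separates row \<open>i\<close> from all other
    rows.\<close>
  have "row G i \<noteq> row G j" if "i < k" "j < k" "i \<noteq> j" for i j
  proof -
    have "row G i $ i \<noteq> row G j $ i"
      using that nz[of i] G form by (auto simp: two_diagonal_form_def)
    then show ?thesis by metis
  qed
  then show dist: "distinct (rows G)"
    using G by (auto simp: distinct_conv_nth)
  have "lin_indpt (set (rows G))"
  proof (rule lin_indpt_rows[OF G dist])
    fix x assume x: "x \<in> carrier_vec k" "transpose_mat G *\<^sub>v x = 0\<^sub>v (2 * k)"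
    have "x $ i = 0" if "i < k" for i
      using two_diagonal_transpose_mult_vec(1)[OF form that x(1)] x(2) nz[OF that] that by simp
    then show "x = 0\<^sub>v k" using x(1) by (intro eq_vecI) auto
  qed
  moreover have "set (rows G) \<subseteq> span (set (rows G))"
    using in_own_span[of "set (rows G)"] rows_subset_carrier_vec[OF G] by auto
  ultimately show "is_basis_of (2 * k) (C (2 * k)) (set (rows G))"
    by (simp add: is_basis_of_def C_def)
  have "span (set (rows G)) = {y \<in> carrier_vec (2 * k). G *\<^sub>v y = 0\<^sub>v k}"
  proof (intro equalityI subsetI)
    fix y assume "y \<in> span (set (rows G))"
    then obtain x where x: "x \<in> carrier_vec k" and y: "y = transpose_mat G *\<^sub>v x"
      unfolding span_rows[OF G] by blast
    have yc: "y \<in> carrier_vec (2 * k)" using G x y by auto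
    have "(G *\<^sub>v y) $ i = 0" if "i < k" for i
    proof -
      have "(G *\<^sub>v y) $ i = ((G $$ (i, i))\<^sup>2 + (G $$ (i, k + i))\<^sup>2) * x $ i"
        using two_diagonal_mult_vec[OF form that yc]
          two_diagonal_transpose_mult_vec[OF form that x] y
        by (simp add: power2_eq_square algebra_simps)
      then show ?thesis using sq[OF that] by simp
    qed
    then show "y \<in> {y \<in> carrier_vec (2 * k). G *\<^sub>v y = 0\<^sub>v k}"
      using yc G by (auto intro!: eq_vecI)
  next
    fix y assume "y \<in> {y \<in> carrier_vec (2 * k). G *\<^sub>v y = 0\<^sub>v k}"
    then have y: "y \<in> carrier_vec (2 * k)" "G *\<^sub>v y = 0\<^sub>v k" by auto
    have "\<forall>i. \<exists>c. i < k \<longrightarrow> G $$ (i, i) * c = 1"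
      using units by (auto simp: dvd_def)
    then obtain d where "\<forall>i. i < k \<longrightarrow> G $$ (i, i) * d i = 1" by (rule choice[THEN exE])
    then have d: "G $$ (i, i) * d i = 1" if "i < k" for i using that by blast
    \<comment> \<open>Here \<open>d i\<close> is the inverse of \<open>G $$ (i, i)\<close>, so the
      first \<open>k\<close> coordinates of the combination match \<open>y\<close> by construction;
      the last \<open>k\<close> need the orthogonality of \<open>y\<close>.\<close>
    define x where "x = vec k (\<lambda>i. d i * y $ i)"
    have x: "x \<in> carrier_vec k" by (simp add: x_def)
    have upper: "(transpose_mat G *\<^sub>v x) $ i = y $ i" if "i < k" for i
      using two_diagonal_transpose_mult_vec(1)[OF form that x] that d[OF that]
      by (simp add: x_def flip: mult.assoc)
    have lower: "(transpose_mat G *\<^sub>v x) $ (k + i) = y $ (k + i)" if "i < k" for i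
    proof -
      let ?a = "G $$ (i, i)" and ?b = "G $$ (i, k + i)"
      have orth: "?a * y $ i = - (?b * y $ (k + i))"
        using two_diagonal_mult_vec[OF form that y(1)] y(2) that
        by (simp add: eq_neg_iff_add_eq_0)
      \<comment> \<open>The desired equation is proved after multiplication by
        \<open>?a * ?a\<close>, which is nonzero and can be cancelled in a domain.\<close>
      have "?a * ?a * (?b * (d i * y $ i)) = ?a * d i * (?b * (?a * y $ i))"
        by (simp add: algebra_simps)
      also have "\<dots> = - ?b\<^sup>2 * y $ (k + i)"
        unfolding orth d[OF that] by (simp add: power2_eq_square)
      also have "\<dots> = ?a * ?a * y $ (k + i)"
        using sq[OF that] by (simp add: power2_eq_square)
      finally have "?b * (d i * y $ i) = y $ (k + i)"
        using nz[OF that] by simp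
      then show ?thesis
        using two_diagonal_transpose_mult_vec(2)[OF form that x] that by (simp add: x_def)
    qed
    have "transpose_mat G *\<^sub>v x = y"
    proof (rule eq_vecI)
      fix j assume "j < dim_vec y"
      then have "j < 2 * k" using y by simp
      then show "(transpose_mat G *\<^sub>v x) $ j = y $ j"
        using upper lower[of "j - k"] by (cases "j < k") auto
    qed (use G y in auto)
    then show "y \<in> span (set (rows G))"
      unfolding span_rows[OF G] using x by blast
  qed
  then show "self_dual (2 * k) (C (2 * k))"
    unfolding self_dual_def C_def dual_code_span_rows[OF G] .
qed

section \<open>Specialization to convolutional codes\<close>

text \<open>The units among the polynomials over a field are the nonzero constants, so the unit
  conditions on the entries become conditions on constants \<open>a\<close> and
  \<open>b\<close>.\<close>

lemma generates_self_dual_code_two_diagonal_iff: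
  fixes G :: "'a::{field,finite} poly mat"
  assumes form: "two_diagonal_form k G"
  shows "generates_self_dual_code (2 * k) k G \<longleftrightarrow>
    (\<forall>i<k. \<exists>a b. G $$ (i, i) = [:a:] \<and> G $$ (i, k + i) = [:b:] \<and>
      a \<noteq> 0 \<and> b \<noteq> 0 \<and> a\<^sup>2 = - (b\<^sup>2))"
proof
  assume "generates_self_dual_code (2 * k) k G"
  then obtain C where C: "is_basis_of (2 * k) C (set (rows G))" "self_dual (2 * k) C"
    by (auto simp: generates_self_dual_code_def generator_matrix_def)
  show "\<forall>i<k. \<exists>a b. G $$ (i, i) = [:a:] \<and> G $$ (i, k + i) = [:b:] \<and>
      a \<noteq> 0 \<and> b \<noteq> 0 \<and> a\<^sup>2 = - (b\<^sup>2)"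
  proof (intro allI impI)
    fix i assume i: "i < k"
    note units = self_dual_two_diagonal_units[OF form C i]
    obtain a where a: "G $$ (i, i) = [:a:]" "a \<noteq> 0"
      using units(1) unfolding is_unit_poly_iff by force
    obtain b where b: "G $$ (i, k + i) = [:b:]" "b \<noteq> 0"
      using units(2) unfolding is_unit_poly_iff by force
    have "a\<^sup>2 = - (b\<^sup>2)"
      using units(3) a b by (simp add: power2_eq_square)
    then show "\<exists>a b. G $$ (i, i) = [:a:] \<and> G $$ (i, k + i) = [:b:] \<and>
      a \<noteq> 0 \<and> b \<noteq> 0 \<and> a\<^sup>2 = - (b\<^sup>2)"
      using a b by blast
  qed
next
  assume *: "\<forall>i<k. \<exists>a b. G $$ (i, i) = [:a:] \<and> G $$ (i, k + i) = [:b:] \<and>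
      a \<noteq> 0 \<and> b \<noteq> 0 \<and> a\<^sup>2 = - (b\<^sup>2)"
  interpret idom_vec "2 * k" "TYPE('a poly)" .
  have G: "G \<in> carrier_mat k (2 * k)"
    using form by (simp add: two_diagonal_form_def)
  have "G $$ (i, i) dvd 1" if "i < k" for i
    using * that unfolding is_unit_poly_iff by (metis dvd_field_iff zero_neq_one)
  moreover have "(G $$ (i, i))\<^sup>2 = - (G $$ (i, k + i))\<^sup>2" if "i < k" for i
  proof -
    obtain a b where "G $$ (i, i) = [:a:]" "G $$ (i, k + i) = [:b:]" "a\<^sup>2 = - (b\<^sup>2)"
      using * \<open>i < k\<close> by blast
    then show ?thesis by (simp add: power2_eq_square)
  qed
  ultimately have "distinct (rows G)" "is_basis_of (2 * k) (span (set (rows G))) (set (rows G))"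
    "self_dual (2 * k) (span (set (rows G)))"
    using units_self_dual_two_diagonal[OF form] by blast+
  \<comment> \<open>Since the \<open>k\<close> rows are distinct, their set is a basis with exactly
    \<open>k\<close> elements, which gives the rank.\<close>
  moreover from this have "convolutional_code (2 * k) k (span (set (rows G)))"
    unfolding convolutional_code_def
    using G span_is_submodule[of "set (rows G)"] rows_subset_carrier_vec[OF G]
    by (auto simp: distinct_card intro!: exI[of _ "set (rows G)"])
  ultimately show "generates_self_dual_code (2 * k) k G"
    using G unfolding generates_self_dual_code_def generator_matrix_def by blast
qed

section \<open>Block codes of length two and the existence statement\<close>

text \<open>An independent set is a maximal independent subset of itself, so its size is the
  dimension of its span.\<close>

lemma block_code_of_basis:
  fixes B :: "'a::{field,finite} vec set"
  assumes "B \<subseteq> carrier_vec n" "finite B" "is_basis_of n C B"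
  shows "block_code n (card B) C"
proof -
  interpret vec_space "TYPE('a)" n .
  have C: "C = span B" and "lin_indpt B"
    using assms(3) by (auto simp: is_basis_of_def)
  then have "maximal B (\<lambda>T. T \<subseteq> B \<and> lin_indpt T)"
    by (auto simp: maximal_def)
  then show ?thesis
    using dim_span[OF _ assms(2)] span_is_subspace assms(1) unfolding block_code_def C by simp
qed

text \<open>A nonzero vector of a self-dual \<open>D\<close> is orthogonal to itself, and its two
  entries solve the equation. Conversely, a solution forms a one-row matrix, to which the criterion
  over domains applies with \<open>k = 1\<close>.\<close>

lemma self_dual_block_code_iff:
  "(\<exists>D :: 'a::{field,finite} vec set. block_code 2 1 D \<and> self_dual 2 D) \<longleftrightarrow>
    (\<exists>a b :: 'a. a \<noteq> 0 \<and> b \<noteq> 0 \<and> a\<^sup>2 = - (b\<^sup>2))"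
proof
  assume "\<exists>D :: 'a vec set. block_code 2 1 D \<and> self_dual 2 D"
  then obtain D :: "'a vec set" where D: "D = dual_code 2 D"
    by (auto simp: self_dual_def)
  have "\<exists>v \<in> D. v \<noteq> 0\<^sub>v 2"
  proof (rule ccontr)
    assume zero: "\<not> (\<exists>v \<in> D. v \<noteq> 0\<^sub>v 2)"
    \<comment> \<open>Without nonzero vectors in \<open>D\<close>, the orthogonality conditions are
      void and the dual is the whole plane.\<close>
    then have "unit_vec 2 0 \<in> dual_code 2 D"
      by (auto simp: dual_code_def)
    moreover have "unit_vec 2 0 \<noteq> (0\<^sub>v 2 :: 'a vec)"
      by (metis index_unit_vec(1) index_zero_vec(1) pos2 zero_neq_one)
    ultimately show False using D zero by blast
  qed
  then obtain v where v: "v \<in> D" "v \<noteq> 0\<^sub>v 2" by blast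
  then have carr: "v \<in> carrier_vec 2" and "v \<bullet> v = 0"
    using D by (auto simp: dual_code_def)
  then have sq: "v $ 0 * v $ 0 + v $ 1 * v $ 1 = 0"
    by (simp add: scalar_prod_def numeral_2_eq_2)
  moreover have "v $ 0 \<noteq> 0 \<or> v $ 1 \<noteq> 0"
    using v(2) carr by (auto simp: vec_eq_iff numeral_2_eq_2 less_Suc_eq)
  \<comment> \<open>The squares of the entries sum to zero, so if one entry vanished, the other
    would too.\<close>
  ultimately have "v $ 0 \<noteq> 0 \<and> v $ 1 \<noteq> 0 \<and> (v $ 0)\<^sup>2 = - ((v $ 1)\<^sup>2)"
    by (auto simp: power2_eq_square eq_neg_iff_add_eq_0)
  then show "\<exists>a b :: 'a. a \<noteq> 0 \<and> b \<noteq> 0 \<and> a\<^sup>2 = - (b\<^sup>2)" by blast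
next
  assume "\<exists>a b :: 'a. a \<noteq> 0 \<and> b \<noteq> 0 \<and> a\<^sup>2 = - (b\<^sup>2)"
  then obtain a b :: 'a where ab: "a \<noteq> 0" "a\<^sup>2 = - (b\<^sup>2)" by blast
  define G where "G = mat 1 2 (\<lambda>(i, j). if j = 0 then a else b)"
  interpret vec_module "TYPE('a)" 2 .
  have G: "G \<in> carrier_mat 1 2" by (simp add: G_def)
  have "two_diagonal_form 1 G"
    by (auto simp: two_diagonal_form_def G_def)
  note code = units_self_dual_two_diagonal[OF this]
  have "is_basis_of 2 (span (set (rows G))) (set (rows G))"
    "self_dual 2 (span (set (rows G)))" "distinct (rows G)"
    using code ab by (simp_all add: G_def dvd_field_iff)
  moreover from this have "card (set (rows G)) = 1"
    by (simp add: distinct_card G_def)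
  ultimately show "\<exists>D :: 'a vec set. block_code 2 1 D \<and> self_dual 2 D"
    using block_code_of_basis[OF rows_subset_carrier_vec[OF G]] by (metis List.finite_set)
qed

theorem mainTheorem4:
  fixes k :: nat
  assumes "k \<ge> 1"
  shows
    "(\<forall>G :: 'a::{field,finite} poly mat. two_diagonal_form k G \<longrightarrow>
        (generates_self_dual_code (2 * k) k G \<longleftrightarrow>
          (\<forall>i<k. \<exists>a b. G $$ (i, i) = [:a:] \<and> G $$ (i, k + i) = [:b:] \<and>
                        a \<noteq> 0 \<and> b \<noteq> 0 \<and> a\<^sup>2 = - (b\<^sup>2)))) \<and>
     ((\<exists>G :: 'a poly mat. two_diagonal_form k G \<and> generates_self_dual_code (2 * k) k G) \<longleftrightarrow>
      (\<exists>D :: 'a vec set. block_code 2 1 D \<and> self_dual 2 D))"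
proof (intro conjI allI impI)
  show "(\<exists>G :: 'a poly mat. two_diagonal_form k G \<and> generates_self_dual_code (2 * k) k G) \<longleftrightarrow>
      (\<exists>D :: 'a vec set. block_code 2 1 D \<and> self_dual 2 D)"
    unfolding self_dual_block_code_iff
  proof
    assume "\<exists>G :: 'a poly mat. two_diagonal_form k G \<and> generates_self_dual_code (2 * k) k G"
    \<comment> \<open>A row exists, and its two constants are the required pair.\<close>
    moreover have "0 < k" using assms by simp
    ultimately show "\<exists>a b :: 'a. a \<noteq> 0 \<and> b \<noteq> 0 \<and> a\<^sup>2 = - (b\<^sup>2)"
      using generates_self_dual_code_two_diagonal_iff by blast
  next
    assume "\<exists>a b :: 'a. a \<noteq> 0 \<and> b \<noteq> 0 \<and> a\<^sup>2 = - (b\<^sup>2)"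
    then obtain a b :: 'a where ab: "a \<noteq> 0" "b \<noteq> 0" "a\<^sup>2 = - (b\<^sup>2)" by blast
    \<comment> \<open>One solution of the equation serves in every row.\<close>
    define G where
      "G = mat k (2 * k) (\<lambda>(i, j). if j = i then [:a:] else if j = k + i then [:b:] else 0)"
    have form: "two_diagonal_form k G"
      by (auto simp: two_diagonal_form_def G_def)
    moreover have "generates_self_dual_code (2 * k) k G"
      unfolding generates_self_dual_code_two_diagonal_iff[OF form]
      using ab by (auto simp: G_def)
    ultimately show "\<exists>G :: 'a poly mat. two_diagonal_form k G \<and>
        generates_self_dual_code (2 * k) k G" by blast
  qed
qed (rule generates_self_dual_code_two_diagonal_iff)

end
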